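(* Let $X$ be a finite skew brace of nilpotent type and let $L=L_\infty(X)$. If $L$ is not an ideal of $X$, then there exists a prime $p$ such that $$p\mid |(L,\cdot)_{\mathrm{ab}}|\qquad\text{and}\qquad p^2\mid[X:L].$$ Consequently, $p^3\mid|X|$. In particular, if $|X|$ is cube-free, then $L$ is an ideal of $X$ and $\mathfrak{R}_L(X)=L$.
   Context: A skew (left) brace is a triple $X=(X,+,\cdot)$ such that $(X,+)$ and $(X,\cdot)$ are groups on the same set and $a\cdot(b+c)=a\cdot b-a+a\cdot c$ for all $a,b,c\in X$. $X$ is of nilpotent type if $(X,+)$ is nilpotent. Put $\lambda_a(b)=-a+a\cdot b$ and $a*b=\lambda_a(b)-b$; for subsets $S,T$, $S*T$ is the subgroup of $(X,+)$ generated by all $s*t$, $s\in S$, $t\in T$. An ideal of $X$ is a subgroup of $(X,+)$ that is invariant under every $\lambda_a$ and normal in both $(X,+)$ and $(X,\cdot)$. The left series is $X^1=X$, $X^{n+1}=X*X^n$; $X$ is left nilpotent if $X^n=0$ for some $n$; $L_\infty(X)=\bigcap_{n\ge1}X^n$, which is a subgroup of both $(X,+)$ and $(X,\cdot)$. The left-nilpotent residual $\mathfrak{R}_L(X)$ is the intersection of all ideals $I$ of $X$ such that $X/I$ is left nilpotent. For a group $H$, $H_{\mathrm{ab}}=H/[H,H]$. $[X:L]=|X|/|L|$. A positive integer is cube-free if it is not divisible by $p^3$ for any prime $p$. *)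

theory Defs
  imports "HOL-Algebra.Generated_Groups" "HOL-Algebra.QuotRing"
    "HOL-Computational_Algebra.Primes"
begin

section \<open>Groups\<close>

text \<open>The lower central series, with \<open>lower_central G 0 = G\<close> and
  \<open>lower_central G (n + 1) = [G, lower_central G n]\<close>.\<close>

primrec lower_central :: "('a, 'b) monoid_scheme \<Rightarrow> nat \<Rightarrow> 'a set" where
  "lower_central G 0 = carrier G"
| "lower_central G (Suc n) =
     generate G (\<Union>x\<in>carrier G. \<Union>y\<in>lower_central G n.
       {x \<otimes>\<^bsub>G\<^esub> y \<otimes>\<^bsub>G\<^esub> inv\<^bsub>G\<^esub> x \<otimes>\<^bsub>G\<^esub> inv\<^bsub>G\<^esub> y})"

definition nilpotent_group :: "('a, 'b) monoid_scheme \<Rightarrow> bool" where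
  "nilpotent_group G \<longleftrightarrow> group G \<and> (\<exists>n. lower_central G n = {\<one>\<^bsub>G\<^esub>})"

definition abelianization :: "('a, 'b) monoid_scheme \<Rightarrow> 'a set monoid" where
  "abelianization G = G Mod derived G (carrier G)"

section \<open>Skew braces\<close>

text \<open>The ring record only serves as a signature here: \<open>add_monoid X\<close> is the group \<open>(X, +)\<close>,
  not assumed commutative, and \<open>X\<close> itself, viewed as a monoid record, is the group \<open>(X, \<cdot>)\<close>.\<close>

locale skew_brace =
  fixes X (structure)
  assumes add_group: "group (add_monoid X)"
    and mult_group: "group X"
    and brace_law: "\<lbrakk>a \<in> carrier X; b \<in> carrier X; c \<in> carrier X\<rbrakk> \<Longrightarrow>
      a \<otimes> (b \<oplus> c) = ((a \<otimes> b) \<ominus> a) \<oplus> (a \<otimes> c)"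

definition brace_lambda :: "('a, 'm) ring_scheme \<Rightarrow> 'a \<Rightarrow> 'a \<Rightarrow> 'a" where
  "brace_lambda X a b = (\<ominus>\<^bsub>X\<^esub> a) \<oplus>\<^bsub>X\<^esub> (a \<otimes>\<^bsub>X\<^esub> b)"

definition brace_star :: "('a, 'm) ring_scheme \<Rightarrow> 'a \<Rightarrow> 'a \<Rightarrow> 'a" where
  "brace_star X a b = brace_lambda X a b \<ominus>\<^bsub>X\<^esub> b"

definition brace_star_set :: "('a, 'm) ring_scheme \<Rightarrow> 'a set \<Rightarrow> 'a set \<Rightarrow> 'a set" where
  "brace_star_set X S T =
     generate (add_monoid X) (\<Union>s\<in>S. \<Union>t\<in>T. {brace_star X s t})"

definition brace_ideal :: "('a, 'm) ring_scheme \<Rightarrow> 'a set \<Rightarrow> bool" where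
  "brace_ideal X I \<longleftrightarrow>
     subgroup I (add_monoid X) \<and>
     (\<forall>a\<in>carrier X. \<forall>b\<in>I. brace_lambda X a b \<in> I) \<and>
     I \<lhd> add_monoid X \<and> I \<lhd> X"

text \<open>Indexed from \<open>1\<close>: the term at index \<open>1\<close> is \<open>X\<close>. The value at the unused index \<open>0\<close>
  is a dummy.\<close>

primrec left_series :: "('a, 'm) ring_scheme \<Rightarrow> nat \<Rightarrow> 'a set" where
  "left_series X 0 = carrier X"
| "left_series X (Suc n) =
     (if n = 0 then carrier X else brace_star_set X (carrier X) (left_series X n))"

definition left_nilpotent :: "('a, 'm) ring_scheme \<Rightarrow> bool" where
  "left_nilpotent X \<longleftrightarrow> (\<exists>n\<ge>1. left_series X n = {\<zero>\<^bsub>X\<^esub>})"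

definition L_infinity :: "('a, 'm) ring_scheme \<Rightarrow> 'a set" where
  "L_infinity X = (\<Inter>n\<in>{1..}. left_series X n)"

text \<open>The quotient of a skew brace by an ideal \<open>I\<close> is \<open>X Quot I\<close>: its elements are the additive
  cosets of \<open>I\<close>, which coincide with the multiplicative ones, and the operations are the induced
  ones (see \<open>rcoset_mult_coset\<close> and \<open>skew_brace_Quot\<close>).\<close>

context skew_brace
begin

lemma one_eq_zero: "\<one> = \<zero>"
proof -
  interpret A: group "add_monoid X" by (rule add_group)
  interpret M: group X by (rule mult_group)
  have z: "\<zero> \<in> carrier X" using A.one_closed by simp
  have i: "\<ominus> \<one> \<in> carrier X" using A.inv_closed[of \<one>] by (simp add: a_inv_def)
  have "\<zero> \<oplus> \<zero> = \<zero>" using A.r_one[of \<zero>] z by simp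
  with brace_law[OF M.one_closed z z] have "\<zero> = (\<zero> \<ominus> \<one>) \<oplus> \<zero>"
    using z by simp
  also have "\<dots> = \<ominus> \<one>"
    using A.r_one[of "\<ominus> \<one>"] A.l_one[of "\<ominus> \<one>"] i by (simp add: a_minus_def)
  finally show ?thesis using A.inv_inv[of \<one>] A.inv_one
    by (simp add: a_inv_def)
qed

lemma mult_eq_add_lambda:
  assumes "a \<in> carrier X" "b \<in> carrier X"
  shows "a \<otimes> b = a \<oplus> brace_lambda X a b"
proof -
  interpret A: group "add_monoid X" by (rule add_group)
  interpret M: group X by (rule mult_group)
  have ab: "a \<otimes> b \<in> carrier X" using assms by simp
  have i: "\<ominus> a \<in> carrier X" using A.inv_closed[of a] assms by (simp add: a_inv_def)
  have "a \<oplus> (\<ominus> a \<oplus> a \<otimes> b) = (a \<oplus> \<ominus> a) \<oplus> a \<otimes> b"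
    using A.m_assoc[of a "\<ominus> a" "a \<otimes> b"] assms i ab by simp
  also have "\<dots> = a \<otimes> b"
    using A.r_inv[of a] A.l_one[of "a \<otimes> b"] assms ab by (simp add: a_inv_def)
  finally show ?thesis by (simp add: brace_lambda_def)
qed

lemma add_coset_eq_mult_coset:
  assumes I: "brace_ideal X I" and a: "a \<in> carrier X"
  shows "I +> a = I #> a"
proof -
  interpret A: group "add_monoid X" by (rule add_group)
  interpret M: group X by (rule mult_group)
  interpret NA: normal I "add_monoid X" using I by (simp add: brace_ideal_def)
  interpret NM: normal I X using I by (simp add: brace_ideal_def)
  have lam: "brace_lambda X b i \<in> I" if "b \<in> carrier X" "i \<in> I" for b i
    using I that by (simp add: brace_ideal_def)
  have sub: "i \<in> carrier X" if "i \<in> I" for i using NM.subset that by auto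
  have "I +> a = a <#\<^bsub>add_monoid X\<^esub> I"
    using NA.coset_eq a by (simp add: a_r_coset_def)
  also have "\<dots> = a <# I"
  proof (intro equalityI subsetI)
    fix x assume "x \<in> a <#\<^bsub>add_monoid X\<^esub> I"
    then obtain i where i: "i \<in> I" "x = a \<oplus> i" by (auto simp: l_coset_def)
    have x: "x \<in> carrier X" using i sub A.m_closed[of a i] a by simp
    have ia: "inv a \<in> carrier X" using a by simp
    have c: "brace_lambda X (inv a) i \<in> carrier X"
      using lam[OF ia i(1)] sub by blast
    have ni: "\<ominus> (inv a) \<in> carrier X" using A.inv_closed[of "inv a"] ia by (simp add: a_inv_def)
    have "inv a \<otimes> x = (\<zero> \<ominus> (inv a)) \<oplus> (inv a \<otimes> i)"
      using brace_law[OF ia a sub[OF i(1)]] i(2) a by (simp add: one_eq_zero)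
    also have "\<dots> = brace_lambda X (inv a) i"
      using A.l_one[of "\<ominus> (inv a)"] ni by (simp add: a_minus_def brace_lambda_def)
    finally have "x = a \<otimes> brace_lambda X (inv a) i"
      using x a ia by (metis M.m_assoc M.r_inv M.l_one)
    then show "x \<in> a <# I" using lam[OF ia i(1)] by (auto simp: l_coset_def)
  next
    fix x assume "x \<in> a <# I"
    then obtain i where "i \<in> I" "x = a \<otimes> i" by (auto simp: l_coset_def)
    then show "x \<in> a <#\<^bsub>add_monoid X\<^esub> I"
      using mult_eq_add_lambda[OF a sub] lam[OF a] by (auto simp: l_coset_def)
  qed
  also have "\<dots> = I #> a" using NM.coset_eq a by simp
  finally show ?thesis .
qed

lemma rcoset_mult_coset:
  assumes I: "brace_ideal X I" and "a \<in> carrier X" "b \<in> carrier X"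
  shows "rcoset_mult X I (I +> a) (I +> b) = I +> (a \<otimes> b)"
proof -
  interpret M: group X by (rule mult_group)
  interpret NM: normal I X using I by (simp add: brace_ideal_def)
  have *: "I +> (x \<otimes> y) = I +> (a \<otimes> b)" if "x \<in> I #> a" "y \<in> I #> b" for x y
  proof -
    have c: "x \<in> carrier X" "y \<in> carrier X"
      using that M.r_coset_subset_G[OF NM.subset] assms by blast+
    have "I #> x = I #> a" "I #> y = I #> b"
      using M.repr_independence[OF _ _ NM.is_subgroup] that assms by metis+
    then have "I #> (x \<otimes> y) = I #> (a \<otimes> b)"
      using NM.rcos_sum c assms by metis
    then show ?thesis
      using add_coset_eq_mult_coset[OF I] c assms by simp
  qed
  have "a \<in> I #> a" "b \<in> I #> b"
    using assms M.rcos_self[OF _ NM.is_subgroup] by auto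
  then show ?thesis
    unfolding rcoset_mult_def using * add_coset_eq_mult_coset[OF I] assms by auto
qed

lemma skew_brace_Quot:
  assumes I: "brace_ideal X I"
  shows "skew_brace (X Quot I)"
proof -
  interpret A: group "add_monoid X" by (rule add_group)
  interpret M: group X by (rule mult_group)
  interpret NA: normal I "add_monoid X" using I by (simp add: brace_ideal_def)
  interpret NM: normal I X using I by (simp add: brace_ideal_def)
  let ?Q = "X Quot I"
  have Qadd: "add_monoid ?Q = add_monoid X Mod I"
    by (simp add: FactRing_def FactGroup_def A_RCOSETS_def set_add_def)
  have ga: "group (add_monoid ?Q)"
    unfolding Qadd by (rule NA.factorgroup_is_group)
  then interpret QA: group "add_monoid ?Q" .
  have car: "carrier ?Q = (\<lambda>a. I +> a) ` carrier X"
    by (auto simp: FactRing_def A_RCOSETS_def' )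
  have add: "(I +> a) \<oplus>\<^bsub>?Q\<^esub> (I +> b) = I +> (a \<oplus> b)" if "a \<in> carrier X" "b \<in> carrier X" for a b
    using NA.rcos_sum[of a b] that by (simp add: FactRing_def a_r_coset_def set_add_def)
  have mul: "(I +> a) \<otimes>\<^bsub>?Q\<^esub> (I +> b) = I +> (a \<otimes> b)" if "a \<in> carrier X" "b \<in> carrier X" for a b
    using rcoset_mult_coset[OF I that] by (simp add: FactRing_def)
  have one: "\<one>\<^bsub>?Q\<^esub> = I +> \<one>" by (simp add: FactRing_def)
  have neg: "\<ominus>\<^bsub>?Q\<^esub> (I +> a) = I +> (\<ominus> a)" if "a \<in> carrier X" for a
    using NA.inv_FactGroup[of "I +> a"] NA.rcos_inv[of a] that
    unfolding a_inv_def Qadd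
    by (simp add: FactGroup_def a_r_coset_def RCOSETS_def) blast
  have negc: "\<ominus> a \<in> carrier X" if "a \<in> carrier X" for a
    using A.inv_closed[of a] that by (simp add: a_inv_def)
  have addc: "a \<oplus> b \<in> carrier X" if "a \<in> carrier X" "b \<in> carrier X" for a b
    using A.m_closed[of a b] that by simp
  have gm: "group ?Q"
  proof (rule groupI)
    fix x assume "x \<in> carrier ?Q"
    then obtain a where a: "a \<in> carrier X" "x = I +> a" by (auto simp: car)
    show "\<exists>y\<in>carrier ?Q. y \<otimes>\<^bsub>?Q\<^esub> x = \<one>\<^bsub>?Q\<^esub>"
      by (rule bexI[of _ "I +> inv a"]) (use a in \<open>auto simp: mul one car\<close>)
  qed (auto simp: car mul one M.m_assoc)
  show ?thesis
  proof (rule skew_brace.intro[OF ga gm])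
    fix x y z assume "x \<in> carrier ?Q" "y \<in> carrier ?Q" "z \<in> carrier ?Q"
    then obtain a b c where *: "a \<in> carrier X" "x = I +> a" "b \<in> carrier X" "y = I +> b"
      "c \<in> carrier X" "z = I +> c" by (auto simp: car)
    then show "x \<otimes>\<^bsub>?Q\<^esub> (y \<oplus>\<^bsub>?Q\<^esub> z) = x \<otimes>\<^bsub>?Q\<^esub> y \<ominus>\<^bsub>?Q\<^esub> x \<oplus>\<^bsub>?Q\<^esub> x \<otimes>\<^bsub>?Q\<^esub> z"
      using brace_law[of a b c]
      by (simp add: add mul neg negc addc a_minus_def)
  qed
qed

end

definition left_nilpotent_residual :: "('a, 'm) ring_scheme \<Rightarrow> 'a set" where
  "left_nilpotent_residual X = \<Inter>{I. brace_ideal X I \<and> left_nilpotent (X Quot I)}"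

definition cube_free :: "nat \<Rightarrow> bool" where
  "cube_free n \<longleftrightarrow> n > 0 \<and> (\<forall>p. Factorial_Ring.prime p \<longrightarrow> \<not> p ^ 3 dvd n)"

end

theory Submission
  imports Defs "HOL-Algebra.SndIsomorphismGrp" "HOL-Algebra.Multiplicative_Group"
begin

text \<open>
  The group \<open>G = (X, \<cdot>)\<close> acts by automorphisms on the group \<open>A = (X, +)\<close> through \<open>\<lambda>\<close>, and the
  left series is the series \<open>A, [A, G], [A, G, G], \<dots>\<close> of this action.  As \<open>X\<close> is finite, the
  series becomes stationary, at \<open>L = [L, G]\<close>.  The argument lives in this setting, with additive
  notation replaced by the multiplicative one.

  The proof that \<open>L\<close> is normal in \<open>A\<close> (\<open>residual_normal\<close>) rests on nilpotency of \<open>A\<close>.  Going up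
  the action series from \<open>L\<close>, one may assume that the next smaller term \<open>A'\<close> normalises \<open>L\<close>;
  let \<open>a\<close> lie in the current term.  The lower central series, refined by the action series, gives
  a chain \<open>A = Z\<^sub>0 \<supseteq> Z\<^sub>1 \<supseteq> \<dots> \<supseteq> 1\<close> with \<open>[A, Z\<^sub>s] \<subseteq> Z\<^bsub>s+1\<^esub>\<close> and
  \<open>[G, Z\<^sub>s] \<subseteq> Z\<^bsub>s+1\<^esub> L\<close>, and \<open>a L a\<inverse> \<subseteq> Z\<^sub>s L\<close> implies \<open>a L a\<inverse> \<subseteq> Z\<^bsub>s+1\<^esub> L\<close>:
  on a generator \<open>g(l) l\<inverse>\<close> of \<open>L\<close>, conjugation by \<open>a\<close> is compared with conjugation by
  \<open>g\<inverse>(a)\<close>, which differs from \<open>a\<close> by an element of \<open>A'\<close>, and the components in \<open>Z\<^sub>s\<close>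
  cancel (\<open>conjugate_residual_step\<close>).

  The prime is found in \<open>nontrivial_action_mod_residual_prime\<close>.  The groups \<open>D\<^sub>s = Z\<^sub>s L\<close> now form a chain of
  normal subgroups from \<open>A\<close> to \<open>L\<close>, whose factors are central and carry the trivial action of \<open>G\<close>.
  If a subgroup \<open>H\<close> of \<open>G\<close> acts nontrivially on \<open>A/L\<close>, let \<open>i\<close> be the last index for which it
  moves \<open>D\<^sub>i\<close> modulo \<open>L\<close>, and \<open>k\<close> the last index with \<open>[H, D\<^sub>i] \<subseteq> D\<^sub>k\<close>.  Then \<open>(h, a) \<mapsto> h(a) a\<inverse>\<close> is a
  nontrivial bimultiplicative map
  \<open>H\<^sub>a\<^sub>b \<times> D\<^sub>i/D\<^bsub>i+1\<^esub> \<rightarrow> D\<^sub>k/D\<^bsub>k+1\<^esub>\<close>, so a prime dividing the order of a nontrivial value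
  divides the orders of all three groups.  As \<open>i < k\<close>, its square divides \<open>[A : L]\<close>.

  For the brace, take \<open>H = L\<close>.  As \<open>L\<close> is normal in \<open>(X, +)\<close> and \<open>\<lambda>\<close>-invariant, it can only
  fail to be an ideal if it acts nontrivially on \<open>X/L\<close> (\<open>brace_ideal_if_acts_trivially\<close>); this gives
  the prime.  The third factor \<open>p\<close> of \<open>|X|\<close> comes from \<open>|L|\<close>.  If \<open>L\<close> is an ideal, it is the
  left-nilpotent residual because the left series of \<open>X/I\<close> is the image of that of \<open>X\<close>.
\<close>

section \<open>Commutators and the lower central series\<close>

context group
begin

lemma inv_cancel_left [simp]:
  assumes "x \<in> carrier G" "y \<in> carrier G"
  shows "inv x \<otimes> (x \<otimes> y) = y" "x \<otimes> (inv x \<otimes> y) = y"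
  using assms by (simp_all flip: m_assoc)

lemma normal_mult_subgroup:
  assumes "N \<lhd> G" "subgroup H G"
  shows "subgroup (N <#> H) G"
  using assms second_isomorphism_grp.normal_set_mult_subgroup
  unfolding second_isomorphism_grp_def second_isomorphism_grp_axioms_def by blast

lemma subset_set_mult:
  assumes "subgroup N G" "subgroup H G"
  shows "N \<subseteq> N <#> H" "H \<subseteq> N <#> H"
proof -
  have "x \<otimes> \<one> \<in> N <#> H" if "x \<in> N" for x
    using that subgroup.one_closed[OF assms(2)] by (auto simp: set_mult_def)
  then show "N \<subseteq> N <#> H"
    using subgroup.mem_carrier[OF assms(1)] by fastforce
  have "\<one> \<otimes> x \<in> N <#> H" if "x \<in> H" for x
    using that subgroup.one_closed[OF assms(1)] by (auto simp: set_mult_def)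
  then show "H \<subseteq> N <#> H"
    using subgroup.mem_carrier[OF assms(2)] by fastforce
qed

lemma normal_if_commutators:
  assumes H: "subgroup H G"
    and comm: "\<And>x y. x \<in> carrier G \<Longrightarrow> y \<in> H \<Longrightarrow> x \<otimes> y \<otimes> inv x \<otimes> inv y \<in> H"
  shows "H \<lhd> G"
  unfolding normal_inv_iff
proof (intro conjI ballI)
  fix x y assume xy: "x \<in> carrier G" "y \<in> H"
  then have "y \<in> carrier G" using subgroup.mem_carrier[OF H] by blast
  with xy have "x \<otimes> y \<otimes> inv x = x \<otimes> y \<otimes> inv x \<otimes> inv y \<otimes> y"
    by (simp add: m_assoc)
  then show "x \<otimes> y \<otimes> inv x \<in> H"
    using comm[OF xy] xy subgroup.m_closed[OF H] by metis
qed (fact H)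

lemma lower_central_subset: "lower_central G n \<subseteq> carrier G"
proof (induction n)
  case (Suc n)
  then show ?case
    unfolding lower_central.simps
    by (intro generate_incl) auto
qed simp

lemma lower_central_subgroup: "subgroup (lower_central G n) G"
proof (cases n)
  case 0
  then show ?thesis by (simp add: subgroup_self)
next
  case (Suc m)
  then show ?thesis
    using lower_central_subset[of m] by (auto intro!: generate_is_subgroup)
qed

lemma commutator_in_lower_central:
  assumes "x \<in> carrier G" "y \<in> lower_central G n"
  shows "x \<otimes> y \<otimes> inv x \<otimes> inv y \<in> lower_central G (Suc n)"
  using assms by (auto intro!: generate.incl)

lemma lower_central_Suc_subset: "lower_central G (Suc n) \<subseteq> lower_central G n"
proof (induction n)
  case 0
  show ?case using lower_central_subset[of 1] by simp
next
  case (Suc n)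
  let ?C = "\<lambda>S. \<Union>x\<in>carrier G. \<Union>y\<in>S. {x \<otimes> y \<otimes> inv x \<otimes> inv y}"
  have "?C (lower_central G (Suc n)) \<subseteq> ?C (lower_central G n)"
    by (intro UN_mono Suc order_refl)
  from mono_generate[OF this] show ?case by (simp only: lower_central.simps(2))
qed

lemma lower_central_normal: "lower_central G n \<lhd> G"
  using lower_central_subgroup
  by (rule normal_if_commutators)
    (meson commutator_in_lower_central lower_central_Suc_subset subsetD)

end

section \<open>Groups acting by automorphisms\<close>

locale automorphism_action = A: group A + G: group G
  for A :: "('a, 'm) monoid_scheme" (structure) and G :: "('g, 'n) monoid_scheme" +
  fixes act :: "'g \<Rightarrow> 'a \<Rightarrow> 'a"
  assumes act_hom: "g \<in> carrier G \<Longrightarrow> act g \<in> hom A A"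
    and act_compose: "\<lbrakk>g \<in> carrier G; h \<in> carrier G; x \<in> carrier A\<rbrakk> \<Longrightarrow>
      act (g \<otimes>\<^bsub>G\<^esub> h) x = act g (act h x)"
    and act_one: "x \<in> carrier A \<Longrightarrow> act \<one>\<^bsub>G\<^esub> x = x"
begin

lemma act_closed [simp, intro]: "\<lbrakk>g \<in> carrier G; x \<in> carrier A\<rbrakk> \<Longrightarrow> act g x \<in> carrier A"
  using act_hom by (auto simp: hom_def)

lemma act_mult [simp]:
  "\<lbrakk>g \<in> carrier G; x \<in> carrier A; y \<in> carrier A\<rbrakk> \<Longrightarrow> act g (x \<otimes> y) = act g x \<otimes> act g y"
  using act_hom by (auto simp: hom_def)

lemma act_group_hom: "g \<in> carrier G \<Longrightarrow> group_hom A A (act g)"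
  using act_hom by (simp add: group_hom_def group_hom_axioms_def A.is_group)

lemma act_inv [simp]: "\<lbrakk>g \<in> carrier G; x \<in> carrier A\<rbrakk> \<Longrightarrow> act g (inv x) = inv (act g x)"
  using group_hom.hom_inv[OF act_group_hom] by blast

lemma act_inverse_cancel: "\<lbrakk>g \<in> carrier G; x \<in> carrier A\<rbrakk> \<Longrightarrow> act g (act (inv\<^bsub>G\<^esub> g) x) = x"
  by (simp add: act_one flip: act_compose)

text \<open>Below, \<open>act g x \<otimes> inv x\<close> is called the displacement of \<open>x\<close> by \<open>g\<close>; it is the commutator of \<open>g\<close>
  and \<open>x\<close> in the semidirect product of \<open>A\<close> and \<open>G\<close>.\<close>
definition act_invariant :: "'a set \<Rightarrow> bool" where
  "act_invariant S \<longleftrightarrow> (\<forall>g\<in>carrier G. \<forall>x\<in>S. act g x \<in> S)"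

lemma act_invariantD: "\<lbrakk>act_invariant S; g \<in> carrier G; x \<in> S\<rbrakk> \<Longrightarrow> act g x \<in> S"
  by (simp add: act_invariant_def)

lemma act_invariant_if_displacements:
  assumes S: "subgroup S A"
    and disp: "\<And>g x. g \<in> carrier G \<Longrightarrow> x \<in> S \<Longrightarrow> act g x \<otimes> inv x \<in> S"
  shows "act_invariant S"
  unfolding act_invariant_def
proof (intro ballI)
  fix g x assume gx: "g \<in> carrier G" "x \<in> S"
  then have "x \<in> carrier A" using subgroup.mem_carrier[OF S] by blast
  with gx have "act g x = act g x \<otimes> inv x \<otimes> x" by (simp add: A.m_assoc)
  then show "act g x \<in> S" using disp[OF gx] gx subgroup.m_closed[OF S] by metis
qed

lemma act_invariant_generate:
  assumes "S \<subseteq> carrier A" "act_invariant S"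
  shows "act_invariant (generate A S)"
  unfolding act_invariant_def
proof (intro ballI)
  fix g x assume g: "g \<in> carrier G" and x: "x \<in> generate A S"
  have "act g ` S \<subseteq> S" using assms(2) g by (auto simp: act_invariant_def)
  then have "generate A (act g ` S) \<subseteq> generate A S" by (rule A.mono_generate)
  then show "act g x \<in> generate A S"
    using group_hom.generate_img[OF act_group_hom[OF g] assms(1)] x by blast
qed

lemma act_invariant_lower_central: "act_invariant (lower_central A n)"
proof (induction n)
  case 0
  show ?case by (auto simp: act_invariant_def)
next
  case (Suc n)
  show ?case
    unfolding lower_central.simps
  proof (rule act_invariant_generate)
    show "act_invariant (\<Union>x\<in>carrier A. \<Union>y\<in>lower_central A n. {x \<otimes> y \<otimes> inv x \<otimes> inv y})"
      unfolding act_invariant_def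
    proof (intro ballI)
      fix g u assume g: "g \<in> carrier G"
        and "u \<in> (\<Union>x\<in>carrier A. \<Union>y\<in>lower_central A n. {x \<otimes> y \<otimes> inv x \<otimes> inv y})"
      then obtain x y where xy: "x \<in> carrier A" "y \<in> lower_central A n"
          "u = x \<otimes> y \<otimes> inv x \<otimes> inv y" by blast
      then have y: "y \<in> carrier A" using A.lower_central_subset by blast
      have "act g u = act g x \<otimes> act g y \<otimes> inv (act g x) \<otimes> inv (act g y)"
        using xy y g by simp
      moreover have "act g x \<in> carrier A" "act g y \<in> lower_central A n"
        using xy g act_invariantD[OF Suc] by auto
      ultimately show "act g u \<in> (\<Union>x\<in>carrier A. \<Union>y\<in>lower_central A n. {x \<otimes> y \<otimes> inv x \<otimes> inv y})"
        by blast
    qed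
  qed (use A.lower_central_subset[of n] in \<open>auto dest!: subsetD\<close>)
qed

text \<open>For the action of a skew brace on its additive group this is the left series, shifted to start
  at index \<open>0\<close>.\<close>
primrec act_series :: "nat \<Rightarrow> 'a set" where
  "act_series 0 = carrier A"
| "act_series (Suc n) =
     generate A (\<Union>g\<in>carrier G. \<Union>x\<in>act_series n. {act g x \<otimes> inv x})"

lemma act_series_subset: "act_series n \<subseteq> carrier A"
proof (induction n)
  case (Suc n)
  then show ?case
    unfolding act_series.simps by (intro A.generate_incl) auto
qed simp

lemma act_series_subgroup: "subgroup (act_series n) A"
proof (cases n)
  case 0
  then show ?thesis by (simp add: A.subgroup_self)
next
  case (Suc m)
  then show ?thesis
    using act_series_subset[of m] by (auto intro!: A.generate_is_subgroup)
qed

lemma displacement_in_act_series: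
  assumes "g \<in> carrier G" "x \<in> act_series n"
  shows "act g x \<otimes> inv x \<in> act_series (Suc n)"
  using assms by (auto intro!: generate.incl)

lemma act_series_Suc_subset: "act_series (Suc n) \<subseteq> act_series n"
proof (induction n)
  case 0
  show ?case using act_series_subset[of 1] by simp
next
  case (Suc n)
  let ?C = "\<lambda>S. \<Union>g\<in>carrier G. \<Union>x\<in>S. {act g x \<otimes> inv x}"
  have "?C (act_series (Suc n)) \<subseteq> ?C (act_series n)"
    by (intro UN_mono Suc order_refl)
  from A.mono_generate[OF this] show ?case by (simp only: act_series.simps(2))
qed

lemma act_series_antimono: "m \<le> n \<Longrightarrow> act_series n \<subseteq> act_series m"
  using lift_Suc_antimono_le[of act_series] act_series_Suc_subset by blast

lemma act_series_invariant: "act_invariant (act_series n)"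
  using act_series_subgroup
  by (rule act_invariant_if_displacements)
    (meson displacement_in_act_series act_series_Suc_subset subsetD)

section \<open>Normality of the residual\<close>

text \<open>The elements \<open>x\<close> with \<open>a x a\<inverse> \<in> M' L\<close> form a subgroup, so it suffices to treat the generators
  \<open>g(l) l\<inverse>\<close> of \<open>L\<close>.  Write \<open>a l a\<inverse> = z l'\<close> and \<open>g\<inverse>(a) = b a\<close>, where \<open>b\<close> normalises \<open>L\<close>.  Then
  \<open>a g(l) a\<inverse> = g(b a l a\<inverse> b\<inverse>) = g(b z l' b\<inverse>)\<close> lies in \<open>M' L z L\<close>, because \<open>M/M'\<close> is central and \<open>G\<close>
  moves \<open>z\<close> only by elements of \<open>M' L\<close>.  Multiplying by \<open>(z l')\<inverse>\<close> leaves an element of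
  \<open>M' L z L z\<inverse>\<close>, which is contained in \<open>M' L\<close> since \<open>z L z\<inverse> \<subseteq> M' L\<close>, again by centrality.\<close>
lemma conjugate_residual_step:
  assumes L: "subgroup L A" and Linv: "act_invariant L"
    and Lgen: "L = generate A (\<Union>g\<in>carrier G. \<Union>x\<in>L. {act g x \<otimes> inv x})"
    and M: "M \<lhd> A" and M': "M' \<lhd> A" and M'inv: "act_invariant M'"
    and comm: "\<And>x z. x \<in> carrier A \<Longrightarrow> z \<in> M \<Longrightarrow> x \<otimes> z \<otimes> inv x \<otimes> inv z \<in> M'"
    and disp: "\<And>g z. g \<in> carrier G \<Longrightarrow> z \<in> M \<Longrightarrow> act g z \<otimes> inv z \<in> M' <#> L"
    and a: "a \<in> carrier A"
    and near: "\<And>g l. g \<in> carrier G \<Longrightarrow> l \<in> L \<Longrightarrow>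
      (act g a \<otimes> inv a) \<otimes> l \<otimes> inv (act g a \<otimes> inv a) \<in> L"
    and conj: "\<And>l. l \<in> L \<Longrightarrow> a \<otimes> l \<otimes> inv a \<in> M <#> L"
    and l: "l \<in> L"
  shows "a \<otimes> l \<otimes> inv a \<in> M' <#> L"
proof -
  let ?P = "M' <#> L"
  interpret M: normal M A by (rule M)
  interpret M': normal M' A by (rule M')
  interpret L: subgroup L A by (rule L)
  interpret P: subgroup ?P A by (rule A.normal_mult_subgroup[OF M' L])
  have sub: "M' \<subseteq> ?P" "L \<subseteq> ?P"
    using A.subset_set_mult[OF M'.is_subgroup L] by auto
  let ?E = "{x \<in> carrier A. a \<otimes> x \<otimes> inv a \<in> ?P}"
  have E: "subgroup ?E A"
  proof (rule A.subgroupI)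
    show "?E \<noteq> {}" using a P.one_closed by (auto intro!: exI[of _ \<one>])
  next
    fix x assume x: "x \<in> ?E"
    have "a \<otimes> inv x \<otimes> inv a = inv (a \<otimes> x \<otimes> inv a)"
      using a x by (simp add: A.inv_mult_group A.m_assoc)
    then show "inv x \<in> ?E" using x by simp
  next
    fix x y assume xy: "x \<in> ?E" "y \<in> ?E"
    have "a \<otimes> (x \<otimes> y) \<otimes> inv a = (a \<otimes> x \<otimes> inv a) \<otimes> (a \<otimes> y \<otimes> inv a)"
      using a xy by (simp add: A.m_assoc)
    then show "x \<otimes> y \<in> ?E" using xy by simp
  qed auto
  have "a \<otimes> (act g l \<otimes> inv l) \<otimes> inv a \<in> ?P" if g: "g \<in> carrier G" and l: "l \<in> L" for g l
  proof -
    define b where "b = act (inv\<^bsub>G\<^esub> g) a \<otimes> inv a"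
    have b: "b \<in> carrier A" using g a by (simp add: b_def)
    have lc: "l \<in> carrier A" using l by (rule L.mem_carrier)
    obtain z l' where z: "z \<in> M" and l': "l' \<in> L" and al: "a \<otimes> l \<otimes> inv a = z \<otimes> l'"
      using conj[OF l] by (auto simp: set_mult_def)
    have zc: "z \<in> carrier A" and l'c: "l' \<in> carrier A" using z l' M.mem_carrier L.mem_carrier by auto
    define l'' where "l'' = b \<otimes> l' \<otimes> inv b"
    have l'': "l'' \<in> L" using near[of "inv\<^bsub>G\<^esub> g" l'] g l' by (simp add: b_def l''_def)
    have l''c: "l'' \<in> carrier A" using l'' by (rule L.mem_carrier)
    define w where "w = b \<otimes> z \<otimes> inv b \<otimes> inv z"
    have w: "w \<in> M'" using comm[OF b z] by (simp add: w_def)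
    have wc: "w \<in> carrier A" using w by (rule M'.mem_carrier)
    \<comment> \<open>The part of the product that remains in \<open>L\<close> once \<open>g(z)\<close> has been cancelled against \<open>z\<close>.\<close>
    define u where "u = act g l'' \<otimes> inv l'"
    have u: "u \<in> L" using l'' l' act_invariantD[OF Linv g] by (simp add: u_def)
    have uc: "u \<in> carrier A" using u by (rule L.mem_carrier)
    have ba: "b \<otimes> a = act (inv\<^bsub>G\<^esub> g) a" using a g by (simp add: b_def A.m_assoc)
    have "act g (b \<otimes> a) = a" using a g by (simp add: ba act_inverse_cancel)
    then have "a \<otimes> act g l \<otimes> inv a = act g (b \<otimes> a) \<otimes> act g l \<otimes> inv (act g (b \<otimes> a))"
      by simp
    also have "\<dots> = act g ((b \<otimes> a) \<otimes> l \<otimes> inv (b \<otimes> a))"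
      using a b g lc by simp
    also have "(b \<otimes> a) \<otimes> l \<otimes> inv (b \<otimes> a) = b \<otimes> (a \<otimes> l \<otimes> inv a) \<otimes> inv b"
      using a b lc by (simp add: A.m_assoc A.inv_mult_group)
    also have "\<dots> = w \<otimes> z \<otimes> l''"
      using b zc l'c by (simp add: al w_def l''_def A.m_assoc A.inv_mult_group)
    finally have 1: "a \<otimes> act g l \<otimes> inv a = act g w \<otimes> act g z \<otimes> act g l''"
      using wc zc l''c g by simp
    have "a \<otimes> (act g l \<otimes> inv l) \<otimes> inv a = (a \<otimes> act g l \<otimes> inv a) \<otimes> inv (a \<otimes> l \<otimes> inv a)"
      using a lc g by (simp add: A.m_assoc A.inv_mult_group)
    also have "\<dots> = act g w \<otimes> (act g z \<otimes> inv z) \<otimes> (u \<otimes> (inv u \<otimes> z \<otimes> inv (inv u) \<otimes> inv z))"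
      unfolding 1 al u_def using wc zc l''c l'c g
      by (simp add: A.inv_mult_group) (simp add: A.m_assoc)
    also have "\<dots> \<in> ?P"
    proof (intro P.m_closed[OF P.m_closed P.m_closed])
      show "act g w \<in> ?P" using act_invariantD[OF M'inv g w] sub by blast
      show "act g z \<otimes> inv z \<in> ?P" by (rule disp[OF g z])
      show "u \<in> ?P" using u sub by blast
      show "inv u \<otimes> z \<otimes> inv (inv u) \<otimes> inv z \<in> ?P"
        using comm[OF A.inv_closed[OF uc] z] sub by blast
    qed
    finally show ?thesis .
  qed
  then have "generate A (\<Union>g\<in>carrier G. \<Union>x\<in>L. {act g x \<otimes> inv x}) \<subseteq> ?E"
    using L.subset by (intro A.generate_subgroup_incl[OF _ E]) auto
  then show ?thesis using l Lgen by auto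
qed


text \<open>The factor \<open>\<gamma>\<^sub>k/\<gamma>\<^bsub>k+1\<^esub>\<close> of the lower central series, on which \<open>G\<close> need not act trivially, is
  refined by the traces of the action series.  The terms are ordered lexicographically in \<open>(k, j)\<close>.
  Normality is automatic, since they lie between \<open>\<gamma>\<^sub>k\<close> and \<open>\<gamma>\<^bsub>k+1\<^esub>\<close>.\<close>
definition refined_term :: "nat \<Rightarrow> nat \<Rightarrow> 'a set" where
  "refined_term k j = lower_central A (Suc k) <#> (lower_central A k \<inter> act_series j)"

lemma refined_term_base_subgroup: "subgroup (lower_central A k \<inter> act_series j) A"
  using A.lower_central_subgroup act_series_subgroup by (rule A.subgroups_Inter_pair)

lemma refined_term_subgroup: "subgroup (refined_term k j) A"
  unfolding refined_term_def
  by (rule A.normal_mult_subgroup[OF A.lower_central_normal refined_term_base_subgroup])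

lemma refined_term_supersets:
  "lower_central A (Suc k) \<subseteq> refined_term k j"
  "lower_central A k \<inter> act_series j \<subseteq> refined_term k j"
  unfolding refined_term_def
  by (rule A.subset_set_mult[OF A.lower_central_subgroup refined_term_base_subgroup])+

lemma refined_term_subset: "refined_term k j \<subseteq> lower_central A k"
  using A.lower_central_Suc_subset[of k] subgroup.m_closed[OF A.lower_central_subgroup[of k]]
  unfolding refined_term_def set_mult_def by blast

lemma refined_term_0: "refined_term k 0 = lower_central A k"
  using refined_term_subset[of k 0] refined_term_supersets(2)[of k 0] A.lower_central_subset[of k] by auto

lemma refined_term_Suc_subset: "refined_term k (Suc j) \<subseteq> refined_term k j"
  unfolding refined_term_def using act_series_Suc_subset by (intro mono_set_mult) auto

lemma refined_term_commutator:
  assumes "x \<in> carrier A" "z \<in> refined_term k j"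
  shows "x \<otimes> z \<otimes> inv x \<otimes> inv z \<in> lower_central A (Suc k)"
  using assms refined_term_subset by (intro A.commutator_in_lower_central) auto

lemma refined_term_normal: "refined_term k j \<lhd> A"
  using refined_term_subgroup
  by (rule A.normal_if_commutators) (meson refined_term_commutator refined_term_supersets subsetD)

lemma refined_term_displacement:
  assumes g: "g \<in> carrier G" and z: "z \<in> refined_term k j"
  shows "act g z \<otimes> inv z \<in> refined_term k (Suc j)"
proof -
  interpret P: subgroup "refined_term k (Suc j)" A by (rule refined_term_subgroup)
  obtain c u where c: "c \<in> lower_central A (Suc k)" and u: "u \<in> lower_central A k" "u \<in> act_series j"
    and zcu: "z = c \<otimes> u"
    using z unfolding refined_term_def set_mult_def by blast
  have cc: "c \<in> carrier A" and uc: "u \<in> carrier A"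
    using c u act_series_subset A.lower_central_subset by blast+
  have "act g u \<otimes> inv u \<in> lower_central A k"
    using act_invariantD[OF act_invariant_lower_central g u(1)] u(1) A.lower_central_subgroup
    by (meson subgroup.m_closed subgroup.m_inv_closed)
  with displacement_in_act_series[OF g u(2)]
  have 1: "act g u \<otimes> inv u \<in> refined_term k (Suc j)"
    using refined_term_supersets(2) by blast
  have 2: "act g c \<in> refined_term k (Suc j)" "inv c \<in> refined_term k (Suc j)"
    using act_invariantD[OF act_invariant_lower_central g c] c
      refined_term_supersets(1)[of k "Suc j"] by auto
  have "act g z \<otimes> inv z = act g c \<otimes> (act g u \<otimes> inv u) \<otimes> inv c"
    using cc uc g by (simp add: zcu A.inv_mult_group A.m_assoc)
  then show ?thesis using P.m_closed[OF P.m_closed[OF 2(1) 1] 2(2)] by simp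
qed

lemma refined_term_invariant: "act_invariant (refined_term k j)"
  using refined_term_subgroup
  by (rule act_invariant_if_displacements)
    (meson refined_term_displacement refined_term_Suc_subset subsetD)

text \<open>The refined terms in lexicographic order, with \<open>j\<close> running up to \<open>m\<close>.  Inside a block \<open>G\<close> moves
  each term into the next one.  The step from \<open>(k, m)\<close> to \<open>(k + 1, 0)\<close> is different: there the
  displacements lie in \<open>\<gamma>\<^bsub>k+1\<^esub> L\<close> only, and for this the factor \<open>L\<close> occurs in the last property.\<close>
lemma obtain_central_chain:
  assumes nil: "nilpotent_group A" and stable: "act_series (Suc m) = act_series m"
  obtains Z r where "Z 0 = carrier A" "Z r = {\<one>}"
    "\<And>s. Z s \<lhd> A" "\<And>s. act_invariant (Z s)" "\<And>s. Z (Suc s) \<subseteq> Z s"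
    "\<And>x z s. x \<in> carrier A \<Longrightarrow> z \<in> Z s \<Longrightarrow> x \<otimes> z \<otimes> inv x \<otimes> inv z \<in> Z (Suc s)"
    "\<And>g z s. g \<in> carrier G \<Longrightarrow> z \<in> Z s \<Longrightarrow>
      act g z \<otimes> inv z \<in> Z (Suc s) <#> act_series m"
proof -
  define Z where "Z s = refined_term (s div Suc m) (s mod Suc m)" for s
  obtain c where c: "lower_central A c = {\<one>}" using nil by (auto simp: nilpotent_group_def)
  have Suc_cases: "Z (Suc s) = refined_term (s div Suc m) (Suc (s mod Suc m)) \<or>
      s mod Suc m = m \<and> Z (Suc s) = lower_central A (Suc (s div Suc m))" for s
  proof (cases "s mod Suc m = m")
    case True
    then have "Suc s mod Suc m = 0" "Suc s div Suc m = Suc (s div Suc m)"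
      by (simp_all add: mod_Suc div_Suc)
    with True show ?thesis unfolding Z_def by (simp only: refined_term_0 simp_thms)
  next
    case False
    then have "Suc s mod Suc m = Suc (s mod Suc m)" "Suc s div Suc m = s div Suc m"
      by (simp_all add: mod_Suc div_Suc)
    then show ?thesis unfolding Z_def by (simp only: simp_thms)
  qed
  have Suc_sup: "lower_central A (Suc (s div Suc m)) \<subseteq> Z (Suc s)" for s
    using Suc_cases[of s] refined_term_supersets(1) by auto
  show thesis
  proof
    show "Z 0 = carrier A" by (simp add: Z_def refined_term_0)
    have "(c * Suc m) div Suc m = c" "(c * Suc m) mod Suc m = 0"
      by (simp_all only: div_mult_self_is_m mod_mult_self2_is_0 zero_less_Suc)
    then show "Z (c * Suc m) = {\<one>}" unfolding Z_def by (simp only: refined_term_0 c)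
    show normal: "Z s \<lhd> A" for s by (simp add: Z_def refined_term_normal)
    show "act_invariant (Z s)" for s by (simp add: Z_def refined_term_invariant)
    show "Z (Suc s) \<subseteq> Z s" for s
    proof -
      have "Z (Suc s) \<subseteq> refined_term (s div Suc m) (s mod Suc m)"
        using Suc_cases[of s] refined_term_Suc_subset refined_term_supersets(1) by metis
      then show ?thesis by (simp only: Z_def)
    qed
    show "x \<otimes> z \<otimes> inv x \<otimes> inv z \<in> Z (Suc s)" if "x \<in> carrier A" "z \<in> Z s" for x z s
      using refined_term_commutator[OF that[unfolded Z_def]] Suc_sup by blast
    show "act g z \<otimes> inv z \<in> Z (Suc s) <#> act_series m" if g: "g \<in> carrier G" and z: "z \<in> Z s" for g z s
    proof -
      have "act g z \<otimes> inv z \<in> refined_term (s div Suc m) (Suc (s mod Suc m))"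
        using refined_term_displacement[OF g z[unfolded Z_def]] .
      also have "\<dots> \<subseteq> Z (Suc s) <#> act_series m"
        using Suc_cases[of s]
      proof (elim disjE conjE)
        assume "Z (Suc s) = refined_term (s div Suc m) (Suc (s mod Suc m))"
        then show ?thesis
          using A.subset_set_mult(1)[OF normal_imp_subgroup[OF normal] act_series_subgroup]
          by metis
      next
        assume "s mod Suc m = m" "Z (Suc s) = lower_central A (Suc (s div Suc m))"
        then show ?thesis
          by (simp only: refined_term_def stable) (intro mono_set_mult Int_lower2 order_refl)
      qed
      finally show ?thesis .
    qed
  qed
qed

text \<open>Two nested inductions: up the action series, until its first term \<open>A\<close> is seen to normalise
  \<open>L\<close>, and for each of its elements along the central chain, where \<open>a L a\<inverse>\<close> is pushed from
  \<open>Z\<^sub>0 L = A\<close> into \<open>1 \<cdot> L\<close>.\<close>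
lemma residual_normal:
  assumes nil: "nilpotent_group A" and stable: "act_series (Suc m) = act_series m"
  shows "act_series m \<lhd> A"
proof -
  let ?L = "act_series m"
  interpret L: subgroup ?L A by (rule act_series_subgroup)
  obtain Z r where Z: "Z 0 = carrier A" "Z r = {\<one>}"
    "\<And>s. Z s \<lhd> A" "\<And>s. act_invariant (Z s)" "\<And>s. Z (Suc s) \<subseteq> Z s"
    "\<And>x z s. x \<in> carrier A \<Longrightarrow> z \<in> Z s \<Longrightarrow> x \<otimes> z \<otimes> inv x \<otimes> inv z \<in> Z (Suc s)"
    "\<And>g z s. g \<in> carrier G \<Longrightarrow> z \<in> Z s \<Longrightarrow> act g z \<otimes> inv z \<in> Z (Suc s) <#> ?L"
    by (rule obtain_central_chain[OF assms]) blast
  have "\<forall>a\<in>act_series 0. \<forall>l\<in>?L. a \<otimes> l \<otimes> inv a \<in> ?L"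
  proof (rule inc_induct[of 0 m])
    show "\<forall>a\<in>?L. \<forall>l\<in>?L. a \<otimes> l \<otimes> inv a \<in> ?L" by auto
  next
    fix n assume IH: "\<forall>a\<in>act_series (Suc n). \<forall>l\<in>?L. a \<otimes> l \<otimes> inv a \<in> ?L"
    show "\<forall>a\<in>act_series n. \<forall>l\<in>?L. a \<otimes> l \<otimes> inv a \<in> ?L"
    proof (intro ballI)
      fix a l assume a: "a \<in> act_series n" and l: "l \<in> ?L"
      have ac: "a \<in> carrier A" using a act_series_subset by blast
      have "\<forall>l\<in>?L. a \<otimes> l \<otimes> inv a \<in> Z s <#> ?L" for s
      proof (induction s)
        case 0
        have "carrier A \<subseteq> Z 0 <#> ?L"
          using A.subset_set_mult(1)[OF A.subgroup_self L.is_subgroup] Z(1) by simp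
        then show ?case using ac by auto
      next
        case (Suc s)
        show ?case
        proof
          fix l assume "l \<in> ?L"
          then show "a \<otimes> l \<otimes> inv a \<in> Z (Suc s) <#> ?L"
            using conjugate_residual_step[OF L.is_subgroup act_series_invariant _ Z(3) Z(3) Z(4) Z(6) Z(7) ac]
              stable Suc IH displacement_in_act_series[OF _ a] by simp
        qed
      qed
      from this[of r] l have "a \<otimes> l \<otimes> inv a \<in> {\<one>} <#> ?L" unfolding Z(2) by blast
      then show "a \<otimes> l \<otimes> inv a \<in> ?L" by (auto simp: set_mult_def)
    qed
  qed simp
  then show ?thesis using L.is_subgroup by (simp add: A.normal_inv_iff)
qed

text \<open>Once \<open>L\<close> is normal, multiplying the central chain by \<open>L\<close> removes its defect: the factors of the
  chain \<open>Z\<^sub>s L\<close> are central and \<open>G\<close> acts trivially on all of them.\<close>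
lemma obtain_central_chain_to_residual:
  assumes nil: "nilpotent_group A" and stable: "act_series (Suc m) = act_series m"
  obtains D r where "D 0 = carrier A" "D r = act_series m"
    "\<And>s. D s \<lhd> A" "\<And>s. D (Suc s) \<subseteq> D s" "\<And>s. act_series m \<subseteq> D s"
    "\<And>x d s. x \<in> carrier A \<Longrightarrow> d \<in> D s \<Longrightarrow> x \<otimes> d \<otimes> inv x \<otimes> inv d \<in> D (Suc s)"
    "\<And>g d s. g \<in> carrier G \<Longrightarrow> d \<in> D s \<Longrightarrow> act g d \<otimes> inv d \<in> D (Suc s)"
proof -
  let ?L = "act_series m"
  obtain Z r where Z: "Z 0 = carrier A" "Z r = {\<one>}"
    "\<And>s. Z s \<lhd> A" "\<And>s. act_invariant (Z s)" "\<And>s. Z (Suc s) \<subseteq> Z s"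
    "\<And>x z s. x \<in> carrier A \<Longrightarrow> z \<in> Z s \<Longrightarrow> x \<otimes> z \<otimes> inv x \<otimes> inv z \<in> Z (Suc s)"
    "\<And>g z s. g \<in> carrier G \<Longrightarrow> z \<in> Z s \<Longrightarrow> act g z \<otimes> inv z \<in> Z (Suc s) <#> ?L"
    by (rule obtain_central_chain[OF assms]) blast
  have LN: "?L \<lhd> A" by (rule residual_normal[OF assms])
  have L: "subgroup ?L A" by (rule act_series_subgroup)
  define D where "D s = Z s <#> ?L" for s
  have DN: "D s \<lhd> A" for s
    unfolding D_def by (rule A.normal_subgroup_set_mult_closed[OF Z(3) LN])
  have sup: "Z s \<subseteq> D s" "?L \<subseteq> D s" for s
    using A.subset_set_mult[OF normal_imp_subgroup[OF Z(3)] L] by (auto simp: D_def)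
  show thesis
  proof
    show "D 0 = carrier A" using sup(1)[of 0] Z(1) normal_imp_subgroup[OF DN[of 0]]
      by (simp add: subgroup.subset subset_antisym)
    show "D r = ?L" using sup(2)[of r] subgroup.mem_carrier[OF L]
      by (auto simp: D_def Z(2) set_mult_def)
    show "D s \<lhd> A" for s by (rule DN)
    show "?L \<subseteq> D s" for s by (rule sup)
    show "D (Suc s) \<subseteq> D s" for s
      unfolding D_def by (intro mono_set_mult Z(5) order_refl)
  next
    fix x d s assume x: "x \<in> carrier A" and "d \<in> D s"
    then obtain z l where z: "z \<in> Z s" and l: "l \<in> ?L" and d: "d = z \<otimes> l"
      by (auto simp: D_def set_mult_def)
    interpret P: normal "D (Suc s)" A by (rule DN)
    have zc: "z \<in> carrier A" and lc: "l \<in> carrier A"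
      using subgroup.mem_carrier[OF normal_imp_subgroup[OF Z(3)] z] subgroup.mem_carrier[OF L l]
      by blast+
    have "x \<otimes> d \<otimes> inv x \<otimes> inv d =
      (x \<otimes> z \<otimes> inv x \<otimes> inv z) \<otimes> (z \<otimes> (x \<otimes> l \<otimes> inv x \<otimes> inv l) \<otimes> inv z)"
      using x zc lc unfolding d by (simp add: A.inv_mult_group) (simp add: A.m_assoc)
    moreover have "x \<otimes> z \<otimes> inv x \<otimes> inv z \<in> D (Suc s)" using Z(6)[OF x z] sup by blast
    moreover have "x \<otimes> l \<otimes> inv x \<otimes> inv l \<in> D (Suc s)"
      using normal.inv_op_closed2[OF LN x l] l sup(2) P.m_closed P.m_inv_closed by blast
    ultimately show "x \<otimes> d \<otimes> inv x \<otimes> inv d \<in> D (Suc s)"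
      using P.inv_op_closed2[OF zc] by (metis P.m_closed)
  next
    fix g d s assume g: "g \<in> carrier G" and "d \<in> D s"
    then obtain z l where z: "z \<in> Z s" and l: "l \<in> ?L" and d: "d = z \<otimes> l"
      by (auto simp: D_def set_mult_def)
    interpret P: normal "D (Suc s)" A by (rule DN)
    have zc: "z \<in> carrier A" and lc: "l \<in> carrier A"
      using subgroup.mem_carrier[OF normal_imp_subgroup[OF Z(3)] z] subgroup.mem_carrier[OF L l]
      by blast+
    have "act g d \<otimes> inv d = (act g z \<otimes> inv z) \<otimes> (z \<otimes> (act g l \<otimes> inv l) \<otimes> inv z)"
      using g zc lc unfolding d by (simp add: A.inv_mult_group) (simp add: A.m_assoc)
    moreover have "act g z \<otimes> inv z \<in> D (Suc s)" using Z(7)[OF g z] by (simp add: D_def)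
    moreover have "act g l \<otimes> inv l \<in> D (Suc s)"
      using act_invariantD[OF act_series_invariant g l] l sup(2) P.m_closed P.m_inv_closed by blast
    ultimately show "act g d \<otimes> inv d \<in> D (Suc s)"
      using P.inv_op_closed2[OF zc] by (metis P.m_closed)
  qed
qed

end

section \<open>The prime forced by a nontrivial action\<close>

text \<open>A homomorphism that kills \<open>N\<close> factors through \<open>G/N\<close>, so the order of each value divides
  \<open>|G/N|\<close>.\<close>
lemma (in group) hom_pow_index_eq_one:
  assumes N: "N \<lhd> G" and Q: "group Q" and f: "f \<in> hom G Q"
    and kernel: "\<And>x. x \<in> N \<Longrightarrow> f x = \<one>\<^bsub>Q\<^esub>" and x: "x \<in> carrier G"
  shows "f x [^]\<^bsub>Q\<^esub> card (carrier (G Mod N)) = \<one>\<^bsub>Q\<^esub>"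
proof -
  interpret N: normal N G by (rule N)
  interpret f: group_hom G Q f
    using Q f by (simp add: group_hom_def group_hom_axioms_def is_group)
  let ?n = "card (carrier (G Mod N))"
  have "N #> x [^] ?n = N"
    using group.pow_order_eq_1[OF N.factorgroup_is_group, of "N #> x"] x
    by (simp add: N.FactGroup_pow order_def carrier_FactGroup)
  then have "x [^] ?n \<in> N"
    using coset_join1 N.subset N.is_subgroup x nat_pow_closed by blast
  then show ?thesis using f.hom_nat_pow[OF x, of ?n] kernel[of "x [^] ?n"] by (simp only:)
qed

lemma (in group) card_quotient_mult:
  assumes K: "subgroup K G" and N: "N \<lhd> G" and NK: "N \<subseteq> K"
  shows "card (carrier (G\<lparr>carrier := K\<rparr> Mod N)) * card N = card K"
proof -
  interpret K: group "G\<lparr>carrier := K\<rparr>" by (rule subgroup_imp_group[OF K])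
  have "subgroup N (G\<lparr>carrier := K\<rparr>)"
    using normal_restrict_supergroup[OF K N NK] by (rule normal_imp_subgroup)
  from K.lagrange[OF this] show ?thesis by (simp add: order_def FactGroup_def)
qed

lemma (in group) hom_trivial_on_derived:
  assumes Q: "group Q" and f: "f \<in> hom G Q"
    and comm: "\<And>x y. x \<in> carrier G \<Longrightarrow> y \<in> carrier G \<Longrightarrow> f x \<otimes>\<^bsub>Q\<^esub> f y = f y \<otimes>\<^bsub>Q\<^esub> f x"
    and x: "x \<in> derived G (carrier G)"
  shows "f x = \<one>\<^bsub>Q\<^esub>"
proof -
  interpret f: group_hom G Q f
    using Q f by (simp add: group_hom_def group_hom_axioms_def is_group)
  have "f (x \<otimes> y \<otimes> inv x \<otimes> inv y) = \<one>\<^bsub>Q\<^esub>" if "x \<in> carrier G" "y \<in> carrier G" for x y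
    using that comm[OF that]
    by (simp add: f.H.m_assoc f.H.inv_mult_group[symmetric] del: f.H.inv_mult_group)
  then have "derived G (carrier G) \<subseteq> kernel G Q f"
    unfolding derived_def
    by (intro generate_subgroup_incl f.subgroup_kernel) (auto simp: kernel_def)
  then show ?thesis using x by (auto simp: kernel_def)
qed

context automorphism_action
begin

text \<open>The value \<open>q\<close> below of the map \<open>H\<^sub>a\<^sub>b \<times> D\<^sub>i/D\<^bsub>i+1\<^esub> \<rightarrow> D\<^sub>k/D\<^bsub>k+1\<^esub>\<close> is nontrivial, and its order divides
  the order of each of the three groups.  The map is multiplicative in both arguments because \<open>D\<^sub>k/D\<^bsub>k+1\<^esub>\<close>
  is central in \<open>A/D\<^bsub>k+1\<^esub>\<close> and has the trivial action.  It kills \<open>D\<^bsub>i+1\<^esub>\<close> because \<open>i\<close> is chosen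
  maximal, and its value at \<open>(h, a)\<close> is nontrivial because \<open>k\<close> is.\<close>
lemma nontrivial_action_mod_residual_prime:
  assumes fin: "finite (carrier A)"
    and nil: "nilpotent_group A" and stable: "act_series (Suc m) = act_series m"
    and H: "subgroup H G"
    and nontriv: "h \<in> H" "a \<in> carrier A" "act h a \<otimes> inv a \<notin> act_series m"
  obtains p :: nat where "Factorial_Ring.prime p"
    "p dvd card (carrier (abelianization (G\<lparr>carrier := H\<rparr>)))"
    "p ^ 2 dvd card (carrier A) div card (act_series m)"
proof -
  let ?L = "act_series m"
  obtain D r where D: "D 0 = carrier A" "D r = ?L"
    "\<And>s. D s \<lhd> A" "\<And>s. D (Suc s) \<subseteq> D s" "\<And>s. ?L \<subseteq> D s"
    "\<And>x d s. x \<in> carrier A \<Longrightarrow> d \<in> D s \<Longrightarrow> x \<otimes> d \<otimes> inv x \<otimes> inv d \<in> D (Suc s)"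
    "\<And>g d s. g \<in> carrier G \<Longrightarrow> d \<in> D s \<Longrightarrow> act g d \<otimes> inv d \<in> D (Suc s)"
    by (rule obtain_central_chain_to_residual[OF nil stable]) blast
  have Dsub: "subgroup (D s) A" for s using D(3) by (rule normal_imp_subgroup)
  have Dcar: "x \<in> carrier A" if "x \<in> D s" for x s
    using subgroup.mem_carrier[OF Dsub that] .
  have Danti: "D t \<subseteq> D s" if "s \<le> t" for s t
    using lift_Suc_antimono_le[of D] D(4) that by blast
  have Hcar: "h \<in> carrier G" if "h \<in> H" for h using subgroup.mem_carrier[OF H that] .

  let ?moves = "\<lambda>i S. \<exists>h\<in>H. \<exists>a\<in>D i. act h a \<otimes> inv a \<notin> S"
  have "\<not> \<not> ?moves 0 ?L" using nontriv D(1) by auto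
  moreover have "\<not> ?moves r ?L"
    using act_invariantD[OF act_series_invariant] Hcar act_series_subgroup
    unfolding D(2) by (meson subgroup.m_closed subgroup.m_inv_closed)
  ultimately obtain i where i: "?moves i ?L" "\<not> ?moves (Suc i) ?L"
    using ex_least_nat_less[of "\<lambda>i. \<not> ?moves i ?L" r] by blast
  have "\<not> ?moves i (D 0)" using Hcar Dcar by (auto simp: D(1))
  moreover have "?moves i (D r)" using i(1) D(2) by simp
  ultimately obtain k where k: "\<not> ?moves i (D k)" "?moves i (D (Suc k))"
    using ex_least_nat_less[of "\<lambda>k. ?moves i (D k)" r] by blast
  \<comment> \<open>The strict inequality \<open>i < k\<close> makes \<open>D\<^sub>i/D\<^bsub>i+1\<^esub>\<close> and \<open>D\<^sub>k/D\<^bsub>k+1\<^esub>\<close> two different factors of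
    \<open>A/L\<close>; this is where the square of \<open>p\<close> comes from.\<close>
  have "\<not> ?moves i (D (Suc i))" using D(7) Hcar by blast
  then have ik: "Suc i \<le> k" using k(2) Danti[of "Suc k" "Suc i"] not_less_eq_eq by blast
  obtain h a where h: "h \<in> H" and a: "a \<in> D i" and ha: "act h a \<otimes> inv a \<notin> D (Suc k)"
    using k(2) by blast

  let ?C = "D (Suc k)" and ?Q = "A Mod D (Suc k)"
  define f where "f h a = ?C #> (act h a \<otimes> inv a)" for h a
  interpret C: normal ?C A by (rule D(3))
  interpret Q: group ?Q by (rule C.factorgroup_is_group)
  have moved: "act h a \<otimes> inv a \<in> D k" if "h \<in> H" "a \<in> D i" for h a
    using k(1) that by blast
  have coset_closed: "?C #> x \<in> carrier ?Q" if "x \<in> carrier A" for x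
    using that by (auto simp: carrier_FactGroup)
  have coset_mult: "?C #> (x \<otimes> y) = (?C #> x) \<otimes>\<^bsub>?Q\<^esub> (?C #> y)"
    if "x \<in> carrier A" "y \<in> carrier A" for x y
    using that by (simp add: C.rcos_sum)
  have coset_one: "?C #> x = \<one>\<^bsub>?Q\<^esub> \<longleftrightarrow> x \<in> ?C" if "x \<in> carrier A" for x
    using that A.coset_join1[OF _ that C.is_subgroup] A.coset_join2[OF that C.is_subgroup]
    by auto
  have coset_eq: "?C #> x = ?C #> y" if "x \<otimes> inv y \<in> ?C" "x \<in> carrier A" "y \<in> carrier A" for x y
    using C.rcos_module[OF A.is_group that(3,2)] that A.repr_independence[OF _ that(3) C.is_subgroup]
    by simp
  have coset_comm: "(?C #> x) \<otimes>\<^bsub>?Q\<^esub> (?C #> y) = (?C #> y) \<otimes>\<^bsub>?Q\<^esub> (?C #> x)"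
    if x: "x \<in> carrier A" and y: "y \<in> D k" for x y
  proof -
    have yc: "y \<in> carrier A" by (rule Dcar[OF y])
    have "(x \<otimes> y) \<otimes> inv (y \<otimes> x) = x \<otimes> y \<otimes> inv x \<otimes> inv y"
      using x yc by (simp add: A.inv_mult_group A.m_assoc)
    then show ?thesis using coset_eq[of "x \<otimes> y" "y \<otimes> x"] D(6)[OF x y] x yc
      by (simp only: coset_mult[symmetric] A.m_closed)
  qed
  have coset_act: "?C #> act g y = ?C #> y" if "g \<in> carrier G" "y \<in> D k" for g y
    using coset_eq[of "act g y" y] D(7)[OF that] Dcar[OF that(2)] that(1) by simp

  have f_left: "f (h \<otimes>\<^bsub>G\<^esub> h') a = f h a \<otimes>\<^bsub>?Q\<^esub> f h' a" if h: "h \<in> H" "h' \<in> H" and a: "a \<in> D i" for h h' a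
  proof -
    have c: "h \<in> carrier G" "h' \<in> carrier G" "a \<in> carrier A" using h a Hcar Dcar by auto
    let ?y = "act h' a \<otimes> inv a"
    have "act (h \<otimes>\<^bsub>G\<^esub> h') a \<otimes> inv a = act h ?y \<otimes> (act h a \<otimes> inv a)"
      using c by (simp add: act_compose A.m_assoc)
    then have "f (h \<otimes>\<^bsub>G\<^esub> h') a = (?C #> act h ?y) \<otimes>\<^bsub>?Q\<^esub> f h a"
      using c by (simp only: f_def coset_mult act_closed A.m_closed A.inv_closed)
    also have "\<dots> = f h' a \<otimes>\<^bsub>?Q\<^esub> f h a"
      using coset_act[OF c(1) moved[OF h(2) a]] by (simp only: f_def)
    also have "\<dots> = f h a \<otimes>\<^bsub>?Q\<^esub> f h' a"
      unfolding f_def using moved[OF h(1) a] c by (intro coset_comm) auto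
    finally show ?thesis .
  qed
  have f_right: "f h (a \<otimes> b) = f h a \<otimes>\<^bsub>?Q\<^esub> f h b" if h: "h \<in> H" and a: "a \<in> D i" and b: "b \<in> D i" for h a b
  proof -
    have c: "h \<in> carrier G" "a \<in> carrier A" "b \<in> carrier A" using h a b Hcar Dcar by auto
    let ?y = "act h b \<otimes> inv b"
    have y: "?y \<in> D k" "?y \<in> carrier A" using moved[OF h b] Dcar by auto
    have "act h (a \<otimes> b) \<otimes> inv (a \<otimes> b) = act h a \<otimes> ?y \<otimes> inv a"
      using c by (simp add: A.inv_mult_group A.m_assoc)
    then have "f h (a \<otimes> b) = (?C #> act h a) \<otimes>\<^bsub>?Q\<^esub> (?C #> ?y) \<otimes>\<^bsub>?Q\<^esub> (?C #> inv a)"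
      using c y by (simp only: f_def coset_mult act_closed A.m_closed A.inv_closed)
    also have "\<dots> = (?C #> act h a) \<otimes>\<^bsub>?Q\<^esub> ((?C #> inv a) \<otimes>\<^bsub>?Q\<^esub> (?C #> ?y))"
      using c y coset_comm[of "inv a" ?y] by (simp only: Q.m_assoc coset_closed act_closed A.inv_closed)
    also have "\<dots> = f h a \<otimes>\<^bsub>?Q\<^esub> f h b"
      using c y by (simp only: f_def coset_mult Q.m_assoc Q.m_closed coset_closed act_closed A.inv_closed)
    finally show ?thesis .
  qed
  have f_closed: "f h a \<in> carrier ?Q" if "h \<in> H" "a \<in> D i" for h a
    using that Hcar Dcar by (auto simp: f_def intro!: coset_closed)

  let ?q = "f h a"
  have q: "?q \<in> carrier ?Q" "?q \<noteq> \<one>\<^bsub>?Q\<^esub>"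
    using f_closed[OF h a] ha coset_one[of "act h a \<otimes> inv a"] h a Hcar Dcar by (auto simp: f_def)

  let ?H = "G\<lparr>carrier := H\<rparr>" and ?Di = "A\<lparr>carrier := D i\<rparr>" and ?Dk = "A\<lparr>carrier := D k\<rparr>"
  let ?n1 = "card (carrier (?Di Mod D (Suc i)))" and ?n2 = "card (carrier (abelianization ?H))"
    and ?n3 = "card (carrier (?Dk Mod ?C))"
  interpret H: group ?H by (rule G.subgroup_imp_group[OF H])
  interpret Di: group ?Di by (rule A.subgroup_imp_group[OF Dsub])
  interpret Dk: group ?Dk by (rule A.subgroup_imp_group[OF Dsub])

  have "?q [^]\<^bsub>?Q\<^esub> ?n1 = \<one>\<^bsub>?Q\<^esub>"
  proof (rule Di.hom_pow_index_eq_one[OF _ Q.is_group, of _ "f h"])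
    show "D (Suc i) \<lhd> ?Di" by (rule A.normal_restrict_supergroup[OF Dsub D(3) D(4)])
    show "f h \<in> hom ?Di ?Q" using f_right[OF h] f_closed[OF h] by (auto simp: hom_def simp del: mult_FactGroup)
    show "f h b = \<one>\<^bsub>?Q\<^esub>" if b: "b \<in> D (Suc i)" for b
    proof -
      have "act h b \<otimes> inv b \<in> ?C" using i(2) h b D(5) by blast
      then show ?thesis unfolding f_def using h b Hcar Dcar by (subst coset_one) auto
    qed
  qed (use a in simp)
  moreover have "?q [^]\<^bsub>?Q\<^esub> ?n2 = \<one>\<^bsub>?Q\<^esub>"
    unfolding abelianization_def
  proof (rule H.hom_pow_index_eq_one[OF H.derived_self_is_normal Q.is_group, of "\<lambda>h. f h a"])
    show hom: "(\<lambda>h. f h a) \<in> hom ?H ?Q"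
      using f_left[OF _ _ a] f_closed[OF _ a] by (auto simp: hom_def simp del: mult_FactGroup)
    show "f x a = \<one>\<^bsub>?Q\<^esub>" if "x \<in> derived ?H (carrier ?H)" for x
      using Q.is_group hom
    proof (rule H.hom_trivial_on_derived)
      show "f x a \<otimes>\<^bsub>?Q\<^esub> f y a = f y a \<otimes>\<^bsub>?Q\<^esub> f x a" if "x \<in> carrier ?H" "y \<in> carrier ?H" for x y
        unfolding f_def using that moved[OF _ a] Dcar by (intro coset_comm) auto
    qed (fact that)
  qed (use h in simp)
  moreover have "?q [^]\<^bsub>?Q\<^esub> ?n3 = \<one>\<^bsub>?Q\<^esub>"
    unfolding f_def
  proof (rule Dk.hom_pow_index_eq_one[OF _ Q.is_group, of _ "\<lambda>x. ?C #> x"])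
    show "?C \<lhd> ?Dk" by (rule A.normal_restrict_supergroup[OF Dsub D(3) D(4)])
    show "(\<lambda>x. ?C #> x) \<in> hom ?Dk ?Q"
      using coset_closed coset_mult Dcar by (auto simp: hom_def simp del: mult_FactGroup)
    show "?C #> x = \<one>\<^bsub>?Q\<^esub>" if "x \<in> ?C" for x
      using coset_one[OF Dcar[OF that]] that by blast
  qed (use moved[OF h a] in simp)
  ultimately have dvd: "Q.ord ?q dvd ?n1" "Q.ord ?q dvd ?n2" "Q.ord ?q dvd ?n3"
    using Q.pow_eq_id[OF q(1)] by blast+
  have "Q.ord ?q \<noteq> 1" using Q.ord_eq_1[OF q(1)] q(2) by blast
  then obtain p where p: "Factorial_Ring.prime p" "p dvd Q.ord ?q"
    using prime_factor_nat by blast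
  obtain u where u: "card (carrier A) = u * card (D i)"
    using A.lagrange[OF Dsub[of i]] by (metis order_def)
  obtain v where v: "card (D (Suc i)) = v * card (D k)"
    using A.card_quotient_mult[OF Dsub D(3) Danti[OF ik]] by metis
  obtain w where w: "card (D (Suc k)) = w * card ?L"
    using A.card_quotient_mult[OF Dsub residual_normal[OF nil stable] D(5)] by metis
  have "card ?L > 0"
    using finite_subset[OF act_series_subset fin] subgroup.one_closed[OF act_series_subgroup]
    by (auto simp: card_gt_0_iff)
  moreover have "card (carrier A) = (u * v * w) * (?n1 * ?n3) * card ?L"
    using u[folded A.card_quotient_mult[OF Dsub D(3) D(4), of i], unfolded v
        A.card_quotient_mult[OF Dsub D(3) D(4), of k, symmetric] w]
    by (simp only: mult_ac)
  ultimately have "card (carrier A) div card ?L = (u * v * w) * (?n1 * ?n3)" by simp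
  moreover have "p * p dvd ?n1 * ?n3"
    using p(2) dvd by (meson dvd_trans mult_dvd_mono)
  ultimately have "p ^ 2 dvd card (carrier A) div card ?L"
    by (simp add: power2_eq_square dvd_mult)
  then show thesis using that p dvd(2) dvd_trans by blast
qed

end

lemma image_eq_singleton_iff: "S \<noteq> {} \<Longrightarrow> f ` S = {c} \<longleftrightarrow> (\<forall>x\<in>S. f x = c)"
  using subset_singleton_iff[of "f ` S" c] by (simp add: image_subset_iff)

section \<open>Skew braces\<close>

context skew_brace
begin

sublocale add: group "add_monoid X"
  rewrites "carrier (add_monoid X) = carrier X"
    and "monoid.mult (add_monoid X) = add X"
    and "one (add_monoid X) = \<zero>"
    and "m_inv (add_monoid X) = a_inv X"
  by (rule add_group) (simp_all add: a_inv_def)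

sublocale mult: group X
  by (rule mult_group)

lemma lambda_closed [simp, intro]:
  "\<lbrakk>a \<in> carrier X; b \<in> carrier X\<rbrakk> \<Longrightarrow> brace_lambda X a b \<in> carrier X"
  by (simp add: brace_lambda_def)

lemma lambda_add:
  assumes "a \<in> carrier X" "b \<in> carrier X" "c \<in> carrier X"
  shows "brace_lambda X a (b \<oplus> c) = brace_lambda X a b \<oplus> brace_lambda X a c"
  using assms by (simp add: brace_lambda_def brace_law a_minus_def add.m_assoc)

lemma lambda_group_hom:
  assumes "a \<in> carrier X"
  shows "group_hom (add_monoid X) (add_monoid X) (brace_lambda X a)"
  using assms lambda_add add_group
  by (auto simp: group_hom_def group_hom_axioms_def hom_def)

lemma lambda_neg:
  assumes "a \<in> carrier X" "b \<in> carrier X"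
  shows "brace_lambda X a (\<ominus> b) = \<ominus> brace_lambda X a b"
  using group_hom.hom_inv[OF lambda_group_hom[OF assms(1)], of b] assms by (simp add: a_inv_def)

lemma lambda_mult:
  assumes a: "a \<in> carrier X" and b: "b \<in> carrier X" and c: "c \<in> carrier X"
  shows "brace_lambda X (a \<otimes> b) c = brace_lambda X a (brace_lambda X b c)"
proof -
  have "brace_lambda X a (brace_lambda X b c) =
      \<ominus> brace_lambda X a b \<oplus> brace_lambda X a (b \<otimes> c)"
    using assms by (simp add: brace_lambda_def[of X b] lambda_add lambda_neg)
  also have "\<dots> = brace_lambda X (a \<otimes> b) c"
    using assms by (simp add: brace_lambda_def add.inv_mult_group add.m_assoc mult.m_assoc)
  finally show ?thesis by simp
qed

lemma lambda_one:
  assumes "b \<in> carrier X"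
  shows "brace_lambda X \<one> b = b"
  using assms by (simp add: brace_lambda_def)
    (simp add: one_eq_zero)

lemma lambda_inverse:
  assumes "a \<in> carrier X"
  shows "brace_lambda X a (inv a) = \<ominus> a"
  using assms by (simp add: brace_lambda_def one_eq_zero)

lemma lambda_action: "automorphism_action (add_monoid X) X (brace_lambda X)"
proof -
  have "brace_lambda X a \<in> hom (add_monoid X) (add_monoid X)" if "a \<in> carrier X" for a
    using lambda_group_hom[OF that] by (simp add: group_hom_def group_hom_axioms_def)
  then show ?thesis
    using add_group mult_group lambda_mult lambda_one
    by (simp add: automorphism_action_def automorphism_action_axioms_def)
qed

interpretation action: automorphism_action "add_monoid X" X "brace_lambda X"
  by (rule lambda_action)

lemma brace_star_eq: "brace_star X a b = brace_lambda X a b \<oplus> \<ominus> b"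
  by (simp add: brace_star_def a_minus_def)

lemma left_series_eq_act_series: "left_series X (Suc n) = action.act_series n"
proof (induction n)
  case (Suc n)
  then show ?case
    by (simp add: brace_star_set_def brace_star_eq a_inv_def)
qed simp

text \<open>In a finite brace a term of least cardinality equals all later ones.\<close>
lemma L_infinity_stable:
  assumes fin: "finite (carrier X)"
  obtains m where "action.act_series (Suc m) = action.act_series m"
    "L_infinity X = action.act_series m"
proof -
  let ?S = action.act_series
  obtain m where m: "\<And>n. card (?S m) \<le> card (?S n)"
    using ex_has_least_nat[of "\<lambda>_. True" _ "\<lambda>n. card (?S n)"] by blast
  have eq: "?S n = ?S m" if "m \<le> n" for n
  proof (rule card_seteq)
    show "finite (?S m)" using finite_subset[OF action.act_series_subset] fin by simp
  qed (use m action.act_series_antimono[OF that] in auto)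
  have "L_infinity X = (\<Inter>n. ?S n)"
    by (simp only: L_infinity_def One_nat_def atLeast_Suc_greaterThan greaterThan_0 image_image
        left_series_eq_act_series)
  also have "\<dots> = ?S m"
  proof
    show "?S m \<subseteq> (\<Inter>n. ?S n)"
      using eq action.act_series_antimono by (metis INT_greatest nle_le order_refl)
  qed blast
  finally show thesis using that eq[of "Suc m"] by simp
qed

text \<open>Closure holds as \<open>a \<cdot> b = a + \<lambda>\<^sub>a(b)\<close>, and inverses exist as \<open>\<lambda>\<^sub>x(a) = -x\<close> for
  \<open>x = a\<inverse>\<close>.\<close>
lemma mult_subgroup_if_lambda_invariant:
  assumes I: "subgroup I (add_monoid X)"
    and lam: "\<And>a b. a \<in> carrier X \<Longrightarrow> b \<in> I \<Longrightarrow> brace_lambda X a b \<in> I"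
  shows "subgroup I X"
proof -
  interpret I: subgroup I "add_monoid X" by (rule I)
  have car: "a \<in> carrier X" if "a \<in> I" for a using I.mem_carrier[OF that] by simp
  show ?thesis
  proof (rule mult.subgroupI)
    show "I \<subseteq> carrier X" "I \<noteq> {}" using car I.one_closed by auto
    show "a \<otimes> b \<in> I" if "a \<in> I" "b \<in> I" for a b
      using I.m_closed[OF that(1) lam[OF car that(2)]] that car
      by (simp add: mult_eq_add_lambda)
    show "inv a \<in> I" if a: "a \<in> I" for a
    proof -
      have "brace_lambda X (inv a) a = \<ominus> (inv a)"
        using lambda_inverse[of "inv a"] car[OF a] by simp
      then have "\<ominus> (inv a) \<in> I" using lam[of "inv a" a] a car by simp
      from I.m_inv_closed[OF this] show "inv a \<in> I" using car[OF a] by (simp flip: a_inv_def)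
    qed
  qed
qed

text \<open>Only normality in \<open>(X, \<cdot>)\<close> is at stake.  If \<open>\<lambda>\<^sub>l(x\<inverse>) = s + x\<inverse>\<close> with \<open>s \<in> I\<close>, then
  \<open>x \<cdot> l \<cdot> x\<inverse> = x + \<lambda>\<^sub>x(l) + \<lambda>\<^sub>x(s) + \<lambda>\<^sub>x(x\<inverse>)\<close>, and the last summand is \<open>-x\<close>: multiplicative conjugation
  turns into additive conjugation of an element of \<open>I\<close>.\<close>
lemma brace_ideal_if_acts_trivially:
  assumes I: "I \<lhd> add_monoid X"
    and lam: "\<And>a b. a \<in> carrier X \<Longrightarrow> b \<in> I \<Longrightarrow> brace_lambda X a b \<in> I"
    and triv: "\<And>a b. a \<in> I \<Longrightarrow> b \<in> carrier X \<Longrightarrow> brace_star X a b \<in> I"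
  shows "brace_ideal X I"
proof -
  interpret I: normal I "add_monoid X" by (rule I)
  have car: "a \<in> carrier X" if "a \<in> I" for a using I.mem_carrier[OF that] by simp
  have mult_subgroup: "subgroup I X"
    using I.is_subgroup lam by (rule mult_subgroup_if_lambda_invariant)
  have "x \<otimes> l \<otimes> inv x \<in> I" if x: "x \<in> carrier X" and l: "l \<in> I" for x l
  proof -
    let ?s = "brace_star X l (inv x)"
    have s: "?s \<in> I" using triv l x by simp
    have lc: "l \<in> carrier X" and sc: "?s \<in> carrier X" using l s car by auto
    have "x \<otimes> l \<otimes> inv x = x \<otimes> (l \<otimes> inv x)"
      using x lc by (simp add: mult.m_assoc)
    also have "\<dots> = x \<oplus> brace_lambda X x (l \<otimes> inv x)"
      using x lc by (intro mult_eq_add_lambda mult.m_closed mult.inv_closed)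
    also have "l \<otimes> inv x = l \<oplus> brace_lambda X l (inv x)"
      using x lc by (simp only: mult_eq_add_lambda mult.inv_closed)
    also have "brace_lambda X l (inv x) = ?s \<oplus> inv x"
      using x lc by (simp add: brace_star_eq add.m_assoc)
    also have "x \<oplus> brace_lambda X x (l \<oplus> (?s \<oplus> inv x)) =
        x \<oplus> (brace_lambda X x l \<oplus> brace_lambda X x ?s) \<oplus> \<ominus> x"
      using x lc sc by (simp add: lambda_add lambda_inverse add.m_assoc)
    also have "\<dots> \<in> I"
      using I.inv_op_closed2[of x "brace_lambda X x l \<oplus> brace_lambda X x ?s"]
        I.m_closed[OF lam[OF x l] lam[OF x s]] x
      by (simp flip: a_inv_def)
    finally show ?thesis .
  qed
  then have "I \<lhd> X" using mult_subgroup by (simp add: mult.normal_inv_iff)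
  then show ?thesis using I I.is_subgroup lam by (simp add: brace_ideal_def)
qed

section \<open>Left nilpotent quotients\<close>

lemma add_coset_hom:
  assumes I: "brace_ideal X I"
  shows "group_hom (add_monoid X) (add_monoid (X Quot I)) (\<lambda>a. I +> a)"
proof -
  interpret NA: normal I "add_monoid X" using I by (simp add: brace_ideal_def)
  have "add_monoid (X Quot I) = add_monoid X Mod I"
    by (simp add: FactRing_def FactGroup_def A_RCOSETS_def set_add_def)
  then show ?thesis
    using NA.r_coset_hom_Mod NA.factorgroup_is_group add_group
    by (simp add: group_hom_def group_hom_axioms_def a_r_coset_def)
qed

lemma carrier_Quot: "carrier (X Quot I) = (\<lambda>a. I +> a) ` carrier X"
  by (auto simp: FactRing_def A_RCOSETS_def')

lemma brace_star_Quot: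
  assumes I: "brace_ideal X I" and a: "a \<in> carrier X" and b: "b \<in> carrier X"
  shows "brace_star (X Quot I) (I +> a) (I +> b) = I +> brace_star X a b"
proof -
  interpret c: group_hom "add_monoid X" "add_monoid (X Quot I)" "\<lambda>a. I +> a"
    by (rule add_coset_hom[OF I])
  have neg: "\<ominus>\<^bsub>X Quot I\<^esub> (I +> x) = I +> (\<ominus> x)" if "x \<in> carrier X" for x
    using c.hom_inv[of x] that by (simp add: a_inv_def)
  have sum: "(I +> x) \<oplus>\<^bsub>X Quot I\<^esub> (I +> y) = I +> (x \<oplus> y)" if "x \<in> carrier X" "y \<in> carrier X" for x y
    using c.hom_mult[of x y] that by simp
  have prod: "(I +> a) \<otimes>\<^bsub>X Quot I\<^esub> (I +> b) = I +> (a \<otimes> b)"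
    using rcoset_mult_coset[OF I a b] by (simp add: FactRing_def)
  show ?thesis
    using a b by (simp add: brace_star_def brace_lambda_def a_minus_def neg sum prod)
qed

lemma left_series_subset: "left_series X n \<subseteq> carrier X"
  using left_series_eq_act_series[of "n - 1"] action.act_series_subset[of "n - 1"]
  by (cases n) auto

text \<open>The coset map is an additive homomorphism that preserves \<open>*\<close>, hence it carries the generators of
  each term of the left series onto those of the corresponding term of the quotient.\<close>
lemma left_series_Quot:
  assumes I: "brace_ideal X I" and n: "1 \<le> n"
  shows "left_series (X Quot I) n = (\<lambda>a. I +> a) ` left_series X n"
  using n
proof (induction n rule: nat_induct_at_least)
  case base
  show ?case by (simp add: carrier_Quot)
next
  case (Suc n)
  interpret c: group_hom "add_monoid X" "add_monoid (X Quot I)" "\<lambda>a. I +> a"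
    by (rule add_coset_hom[OF I])
  let ?gens = "\<Union>s\<in>carrier X. \<Union>t\<in>left_series X n. {brace_star X s t}"
  have gens: "?gens \<subseteq> carrier X"
    using left_series_subset[of n] by (auto simp: brace_star_eq)
  have "(\<Union>s\<in>carrier (X Quot I). \<Union>t\<in>left_series (X Quot I) n. {brace_star (X Quot I) s t}) =
      (\<lambda>a. I +> a) ` ?gens"
    using left_series_subset[of n]
    by (auto simp: carrier_Quot Suc.IH brace_star_Quot[OF I] subset_iff image_UN)
  then show ?case
    using c.generate_img[OF gens] Suc.hyps by (simp add: brace_star_set_def)
qed

lemma left_nilpotent_Quot_iff:
  assumes I: "brace_ideal X I"
  shows "left_nilpotent (X Quot I) \<longleftrightarrow> (\<exists>n\<ge>1. left_series X n \<subseteq> I)"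
proof -
  interpret NA: normal I "add_monoid X" using I by (simp add: brace_ideal_def)
  have coset: "I +> x = I \<longleftrightarrow> x \<in> I" if "x \<in> carrier X" for x
    using that add.coset_join1[OF _ that] add.coset_join2[OF that] NA.is_subgroup
    by (auto simp: a_r_coset_def)
  have "left_series (X Quot I) n = {\<zero>\<^bsub>X Quot I\<^esub>} \<longleftrightarrow> left_series X n \<subseteq> I" if n: "1 \<le> n" for n
  proof -
    obtain k where k: "n = Suc k" using n by (cases n) auto
    have "left_series X n \<noteq> {}"
      using subgroup.one_closed[OF action.act_series_subgroup[of k]]
      unfolding k left_series_eq_act_series by blast
    then have "(\<lambda>a. I +> a) ` left_series X n = {I} \<longleftrightarrow> (\<forall>x\<in>left_series X n. I +> x = I)"
      by (rule image_eq_singleton_iff)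
    also have "\<dots> \<longleftrightarrow> left_series X n \<subseteq> I"
      using left_series_subset[of n] coset by blast
    finally show ?thesis
      unfolding left_series_Quot[OF I n] by (simp add: FactRing_def)
  qed
  then show ?thesis unfolding left_nilpotent_def by metis
qed

lemma left_nilpotent_residual_eq_L_infinity:
  assumes fin: "finite (carrier X)" and I: "brace_ideal X (L_infinity X)"
  shows "left_nilpotent_residual X = L_infinity X"
proof
  obtain m where m: "L_infinity X = action.act_series m"
    by (rule L_infinity_stable[OF fin])
  have "1 \<le> Suc m" "left_series X (Suc m) \<subseteq> L_infinity X"
    by (simp_all only: m left_series_eq_act_series order_refl One_nat_def Suc_le_mono le0)
  then have "left_nilpotent (X Quot L_infinity X)"
    using left_nilpotent_Quot_iff[OF I] by blast
  then show "left_nilpotent_residual X \<subseteq> L_infinity X"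
    using I unfolding left_nilpotent_residual_def by blast
  show "L_infinity X \<subseteq> left_nilpotent_residual X"
    unfolding left_nilpotent_residual_def
  proof (rule Inter_greatest)
    fix J assume "J \<in> {I. brace_ideal X I \<and> left_nilpotent (X Quot I)}"
    then obtain n where "1 \<le> n" "left_series X n \<subseteq> J"
      using left_nilpotent_Quot_iff by blast
    then show "L_infinity X \<subseteq> J" 
      unfolding L_infinity_def by (meson INT_lower atLeast_iff order_trans)
  qed
qed

section \<open>When the limit of the left series is not an ideal\<close>

text \<open>\<open>L\<close> plays two roles here: as a normal subgroup of \<open>(X, +)\<close> it is the residual of the action, and as a
  subgroup of \<open>(X, \<cdot>)\<close> it acts on \<open>X/L\<close>.\<close>
lemma prime_if_L_infinity_not_ideal:
  assumes fin: "finite (carrier X)" and nil: "nilpotent_group (add_monoid X)"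
    and not_ideal: "\<not> brace_ideal X (L_infinity X)"
  obtains p :: nat where "Factorial_Ring.prime p"
    "p dvd card (carrier (abelianization (X\<lparr>carrier := L_infinity X\<rparr>)))"
    "p ^ 2 dvd card (carrier X) div card (L_infinity X)"
    "p ^ 3 dvd card (carrier X)"
proof -
  let ?L = "L_infinity X"
  obtain m where stable: "action.act_series (Suc m) = action.act_series m"
    and m: "?L = action.act_series m"
    by (rule L_infinity_stable[OF fin])
  have N: "?L \<lhd> add_monoid X"
    unfolding m by (rule action.residual_normal[OF nil stable])
  have lam: "brace_lambda X a b \<in> ?L" if "a \<in> carrier X" "b \<in> ?L" for a b
    using that action.act_invariantD[OF action.act_series_invariant] unfolding m by blast
  have sub: "subgroup ?L X"
    using normal_imp_subgroup[OF N] lam by (rule mult_subgroup_if_lambda_invariant)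
  obtain h a where "h \<in> ?L" "a \<in> carrier X" "brace_star X h a \<notin> ?L"
    using brace_ideal_if_acts_trivially[OF N lam] not_ideal by blast
  then obtain p :: nat where p: "Factorial_Ring.prime p"
    "p dvd card (carrier (abelianization (X\<lparr>carrier := ?L\<rparr>)))"
    "p ^ 2 dvd card (carrier X) div card ?L"
    using action.nontrivial_action_mod_residual_prime[OF _ nil stable sub, of h a] fin
    by (auto simp: m brace_star_eq a_inv_def)
  interpret L: group "X\<lparr>carrier := ?L\<rparr>" by (rule mult.subgroup_imp_group[OF sub])
  have "card (carrier (abelianization (X\<lparr>carrier := ?L\<rparr>))) *
      card (derived (X\<lparr>carrier := ?L\<rparr>) ?L) = card ?L"
    using L.lagrange[OF normal_imp_subgroup[OF L.derived_self_is_normal]]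
    by (simp add: abelianization_def FactGroup_def order_def)
  then have "card (carrier (abelianization (X\<lparr>carrier := ?L\<rparr>))) dvd card ?L"
    by (metis dvd_triv_left)
  then have "p dvd card ?L" using p(2) dvd_trans by blast
  then have "p ^ 2 * p dvd card (carrier X) div card ?L * card ?L"
    using p(3) mult_dvd_mono by blast
  also have "card (carrier X) div card ?L * card ?L = card (carrier X)"
    using mult.lagrange[OF sub] by (metis order_def dvd_triv_right dvd_div_mult_self)
  finally have "p ^ 3 dvd card (carrier X)" by (simp add: eval_nat_numeral mult_ac)
  then show thesis using that p by blast
qed

end

theorem corollary6p13:
  fixes X :: "('a, 'm) ring_scheme"
  assumes "skew_brace X"
    and "finite (carrier X)"
    and "nilpotent_group (add_monoid X)"
  defines "L \<equiv> L_infinity X"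
  shows "(\<not> brace_ideal X L \<longrightarrow>
           (\<exists>p::nat. Factorial_Ring.prime p
              \<and> p dvd card (carrier (abelianization (X\<lparr>carrier := L\<rparr>)))
              \<and> p ^ 2 dvd card (carrier X) div card L
              \<and> p ^ 3 dvd card (carrier X)))
       \<and> (cube_free (card (carrier X)) \<longrightarrow>
           brace_ideal X L \<and> left_nilpotent_residual X = L)"
proof -
  interpret skew_brace X by fact
  have "\<exists>p::nat. Factorial_Ring.prime p
      \<and> p dvd card (carrier (abelianization (X\<lparr>carrier := L\<rparr>)))
      \<and> p ^ 2 dvd card (carrier X) div card L
      \<and> p ^ 3 dvd card (carrier X)" if "\<not> brace_ideal X L"
    using prime_if_L_infinity_not_ideal[OF assms(2,3)] that unfolding L_def by metis
  moreover from this have "brace_ideal X L" if "cube_free (card (carrier X))"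
    using that unfolding cube_free_def by blast
  ultimately show ?thesis
    using left_nilpotent_residual_eq_L_infinity[OF assms(2)] unfolding L_def by blast
qed

end
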